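(* The square-root map $$\Phi:(\Delta,\mathcal{G}^{\mathrm{FR}})\longrightarrow(\mathcal{U},\mathcal{G}^{\ell^2}),\qquad (p_n)\longmapsto(\sqrt{p_n}),$$ is an isometry; that is, $\Phi$ is a diffeomorphism and $$\mathcal{G}^{\ell^2}_{\Phi(p)}\big(d\Phi_p(v),d\Phi_p(w)\big)=\mathcal{G}^{\mathrm{FR}}_{p}(v,w)\qquad\text{for all }p=(p_n)\in\Delta,\ v,w\in T_p\Delta.$$
   Context: $\ell^2_{\mathbb{R}}$ is the real Hilbert space of square-summable real sequences $(x_n)_{n\in\mathbb{N}}$ (indices start at $0$), with inner product $\langle(x_n),(y_n)\rangle_{\ell^2}=\sum_{n\ge0}x_ny_n$; $\mathbb{S}(\ell^2_{\mathbb{R}})$ is its unit sphere, with tangent space at $x$ equal to $\{v\in\ell^2_{\mathbb{R}}:\langle x,v\rangle_{\ell^2}=0\}$. The round metric $\mathcal{G}^{\ell^2}$ is the restriction of $\langle\cdot,\cdot\rangle_{\ell^2}$ to the tangent spaces of the sphere. $\mathcal{U}:=\{(x_n)\in\mathbb{S}(\ell^2_{\mathbb{R}}):x_n>0\ \forall n\in\mathbb{N}\}$, with the differentiable structure, tangent spaces and metric $\mathcal{G}^{\ell^2}$ inherited from the sphere. The $\ell^2$-probability simplex is $\Delta:=\{(p_n)\in\ell^1_{\mathbb{R}}:\sum_{n\ge0}p_n=1,\ p_n>0\ \forall n\}$. It is equipped with the differentiable structure for which the bijection $\Phi:\Delta\to\mathcal{U}$, $(p_n)\mapsto(\sqrt{p_n})$,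 is a diffeomorphism. With respect to it (tangent vectors written as entrywise derivatives of curves), $$T_{(p_n)}\Delta=\Big\{(v_n)\in\ell^1_{\mathbb{R}}:\sum_{n\ge0}v_n=0,\ \Big(\tfrac{v_n}{\sqrt{p_n}}\Big)\in\ell^2_{\mathbb{R}}\Big\}.$$ The $\ell^2$-Fisher--Rao metric is $\mathcal{G}^{\mathrm{FR}}_{(p_n)}((v_n),(w_n)):=\frac14\sum_{n\ge0}\frac{v_nw_n}{p_n}$ for $(v_n),(w_n)\in T_{(p_n)}\Delta$. *)

theory Defs
  imports "HOL-Analysis.Analysis"
begin

section \<open>Square-summable real sequences\<close>

definition square_summable :: "(nat \<Rightarrow> real) \<Rightarrow> bool" where
  "square_summable x \<longleftrightarrow> summable (\<lambda>n. (x n)\<^sup>2)"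

definition abs_summable :: "(nat \<Rightarrow> real) \<Rightarrow> bool" where
  "abs_summable x \<longleftrightarrow> summable (\<lambda>n. \<bar>x n\<bar>)"

lemma square_summable_zero: "square_summable (\<lambda>n. 0)"
  by (simp add: square_summable_def)

lemma square_summable_add:
  assumes "square_summable x" "square_summable y"
  shows "square_summable (\<lambda>n. x n + y n)"
  unfolding square_summable_def
proof (rule summable_comparison_test')
  show "summable (\<lambda>n. 2 * (x n)\<^sup>2 + 2 * (y n)\<^sup>2)"
    using assms unfolding square_summable_def by (intro summable_add summable_mult)
  show "norm ((x n + y n)\<^sup>2) \<le> 2 * (x n)\<^sup>2 + 2 * (y n)\<^sup>2" if "0 \<le> n" for n
    using sum_squares_bound[of "x n" "y n"] zero_le_power2[of "x n + y n"]
    unfolding real_norm_def power2_sum by linarith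
qed

lemma square_summable_scale:
  "square_summable x \<Longrightarrow> square_summable (\<lambda>n. c * x n)"
  by (simp add: square_summable_def power_mult_distrib summable_mult)

lemma square_summable_diff:
  assumes "square_summable x" "square_summable y"
  shows "square_summable (\<lambda>n. x n - y n)"
  using square_summable_add[OF assms(1) square_summable_scale[OF assms(2), of "-1"]] by simp

lemma square_summable_mult:
  assumes "square_summable x" "square_summable y"
  shows "abs_summable (\<lambda>n. x n * y n)"
  unfolding abs_summable_def
proof (rule summable_comparison_test')
  show "summable (\<lambda>n. (x n)\<^sup>2 + (y n)\<^sup>2)"
    using assms unfolding square_summable_def by (intro summable_add)
  show "norm \<bar>x n * y n\<bar> \<le> (x n)\<^sup>2 + (y n)\<^sup>2" if "0 \<le> n" for n
  proof -
    have "2 * (\<bar>x n\<bar> * \<bar>y n\<bar>) \<le> (x n)\<^sup>2 + (y n)\<^sup>2"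
      using sum_squares_bound[of "\<bar>x n\<bar>" "\<bar>y n\<bar>"] by (simp add: mult.assoc)
    moreover have "0 \<le> \<bar>x n\<bar> * \<bar>y n\<bar>" by simp
    ultimately show ?thesis unfolding real_norm_def abs_abs abs_mult by linarith
  qed
qed

lemma abs_summable_imp_summable: "abs_summable x \<Longrightarrow> summable x"
  unfolding abs_summable_def by (rule summable_rabs_cancel)


section \<open>The real Hilbert space of square-summable sequences\<close>

typedef ell2 = "{x :: nat \<Rightarrow> real. square_summable x}"
  morphisms ell2_nth ell2_of
  using square_summable_zero by blast

setup_lifting type_definition_ell2

lemma square_summable_nth: "square_summable (ell2_nth x)"
  using ell2_nth[of x] by simp

lemma ell2_nth_of: "square_summable x \<Longrightarrow> ell2_nth (ell2_of x) = x"
  by (simp add: ell2_of_inverse)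

lemma ell2_eqI: "(\<And>n. ell2_nth x n = ell2_nth y n) \<Longrightarrow> x = y"
  by (simp add: ell2_nth_inject[symmetric] fun_eq_iff)

instantiation ell2 :: real_inner
begin

lift_definition zero_ell2 :: ell2 is "\<lambda>n. 0"
  by (rule square_summable_zero)

lift_definition plus_ell2 :: "ell2 \<Rightarrow> ell2 \<Rightarrow> ell2" is "\<lambda>x y n. x n + y n"
  by (rule square_summable_add)

lift_definition minus_ell2 :: "ell2 \<Rightarrow> ell2 \<Rightarrow> ell2" is "\<lambda>x y n. x n - y n"
  by (rule square_summable_diff)

lift_definition uminus_ell2 :: "ell2 \<Rightarrow> ell2" is "\<lambda>x n. - x n"
  by (simp add: square_summable_def)

lift_definition scaleR_ell2 :: "real \<Rightarrow> ell2 \<Rightarrow> ell2" is "\<lambda>c x n. c * x n"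
  by (rule square_summable_scale)

lift_definition inner_ell2 :: "ell2 \<Rightarrow> ell2 \<Rightarrow> real" is "\<lambda>x y. \<Sum>n. x n * y n" .

definition norm_ell2 :: "ell2 \<Rightarrow> real" where "norm_ell2 x = sqrt (inner x x)"
definition dist_ell2 :: "ell2 \<Rightarrow> ell2 \<Rightarrow> real" where "dist_ell2 x y = norm (x - y)"
definition sgn_ell2 :: "ell2 \<Rightarrow> ell2" where "sgn_ell2 x = inverse (norm x) *\<^sub>R x"
definition uniformity_ell2 :: "(ell2 \<times> ell2) filter" where
  "uniformity_ell2 = (INF e\<in>{0 <..}. principal {(x, y). dist x y < e})"
definition open_ell2 :: "ell2 set \<Rightarrow> bool" where
  "open_ell2 U \<longleftrightarrow> (\<forall>x\<in>U. eventually (\<lambda>(x', y). x' = x \<longrightarrow> y \<in> U) uniformity)"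

instance
proof
  fix x y z :: ell2 and a b :: real and U :: "ell2 set"
  have mult: "summable (\<lambda>n. ell2_nth u n * ell2_nth v n)" for u v
    by (rule abs_summable_imp_summable[OF square_summable_mult]) (rule square_summable_nth)+
  show "x + y + z = x + (y + z)" "x + y = y + x" "0 + x = x" "- x + x = 0" "x - y = x + - y"
    "a *\<^sub>R (x + y) = a *\<^sub>R x + a *\<^sub>R y" "(a + b) *\<^sub>R x = a *\<^sub>R x + b *\<^sub>R x"
    "a *\<^sub>R b *\<^sub>R x = (a * b) *\<^sub>R x" "1 *\<^sub>R x = x"
    by (transfer; simp add: algebra_simps)+
  show "dist x y = norm (x - y)" by (rule dist_ell2_def)
  show "sgn x = inverse (norm x) *\<^sub>R x" by (rule sgn_ell2_def)
  show "uniformity = (INF e\<in>{0 <..}. principal {(x :: ell2, y). dist x y < e})"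
    by (rule uniformity_ell2_def)
  show "open U \<longleftrightarrow> (\<forall>x\<in>U. eventually (\<lambda>(x', y). x' = x \<longrightarrow> y \<in> U) uniformity)"
    by (rule open_ell2_def)
  show "inner x y = inner y x" by transfer (simp add: mult.commute)
  show "inner (x + y) z = inner x z + inner y z"
    using suminf_add[OF mult[of x z] mult[of y z]]
    by (simp add: inner_ell2.rep_eq plus_ell2.rep_eq distrib_right)
  show "inner (a *\<^sub>R x) y = a * inner x y"
    using suminf_mult[OF mult[of x y], of a]
    by (simp add: inner_ell2.rep_eq scaleR_ell2.rep_eq mult.assoc)
  show "0 \<le> inner x x"
    unfolding inner_ell2.rep_eq by (rule suminf_nonneg[OF mult]) simp
  show "inner x x = 0 \<longleftrightarrow> x = 0"
  proof
    assume "inner x x = 0"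
    then have "\<forall>n. ell2_nth x n * ell2_nth x n = 0"
      using suminf_eq_zero_iff[OF mult[of x x]] by (simp add: inner_ell2.rep_eq)
    then show "x = 0" by (intro ell2_eqI) (simp add: zero_ell2.rep_eq)
  qed (simp add: inner_ell2.rep_eq zero_ell2.rep_eq)
  show "norm x = sqrt (inner x x)" by (rule norm_ell2_def)
qed

end

lemma ell2_norm_square: "(\<lambda>n. (ell2_nth x n)\<^sup>2) sums (norm x)\<^sup>2"
  using summable_sums[OF square_summable_nth[of x, unfolded square_summable_def]]
  unfolding power2_norm_eq_inner inner_ell2.rep_eq by (simp only: power2_eq_square)

lemma abs_ell2_nth_le: "\<bar>ell2_nth x n\<bar> \<le> norm x"
proof -
  have "(\<Sum>i\<in>{n}. (ell2_nth x i)\<^sup>2) \<le> (norm x)\<^sup>2"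
    using ell2_norm_square[of x] by (intro sum_le_suminf[THEN order_trans])
      (auto simp: sums_iff)
  then show ?thesis by (simp add: abs_le_square_iff[symmetric])
qed

instance ell2 :: banach
proof
  fix X :: "nat \<Rightarrow> ell2"
  assume X: "Cauchy X"
  have "Cauchy (\<lambda>m. ell2_nth (X m) n)" for n
  proof (rule metric_CauchyI)
    fix e :: real assume "0 < e"
    then obtain M where M: "\<And>m k. m \<ge> M \<Longrightarrow> k \<ge> M \<Longrightarrow> dist (X m) (X k) < e"
      using X unfolding Cauchy_def by blast
    have "dist (ell2_nth (X m) n) (ell2_nth (X k) n) < e" if "m \<ge> M" "k \<ge> M" for m k
      using M[OF that] abs_ell2_nth_le[of "X m - X k" n]
      by (simp add: dist_norm minus_ell2.rep_eq)
    then show "\<exists>M. \<forall>m\<ge>M. \<forall>k\<ge>M. dist (ell2_nth (X m) n) (ell2_nth (X k) n) < e" by blast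
  qed
  then have "\<forall>n. \<exists>l. (\<lambda>m. ell2_nth (X m) n) \<longlonglongrightarrow> l"
    by (simp add: Cauchy_convergent_iff convergent_def)
  then obtain l where l: "\<And>n. (\<lambda>m. ell2_nth (X m) n) \<longlonglongrightarrow> l n" by metis
  have part: "(\<Sum>n<K. (ell2_nth (X m) n - l n)\<^sup>2) \<le> e\<^sup>2"
    if M: "\<forall>m\<ge>M. \<forall>k\<ge>M. dist (X m) (X k) < e" and m: "m \<ge> M" for e M m K
  proof (rule LIMSEQ_le_const2)
    show "(\<lambda>k. \<Sum>n<K. (ell2_nth (X m) n - ell2_nth (X k) n)\<^sup>2)
        \<longlonglongrightarrow> (\<Sum>n<K. (ell2_nth (X m) n - l n)\<^sup>2)"
      by (intro tendsto_intros l)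
    have "(\<Sum>n<K. (ell2_nth (X m) n - ell2_nth (X k) n)\<^sup>2) \<le> e\<^sup>2" if "k \<ge> M" for k
    proof -
      have "(\<Sum>n<K. (ell2_nth (X m - X k) n)\<^sup>2) \<le> (norm (X m - X k))\<^sup>2"
        using ell2_norm_square[of "X m - X k"]
        by (intro sum_le_suminf[THEN order_trans]) (auto simp: sums_iff)
      also have "\<dots> \<le> e\<^sup>2"
        using M[rule_format, OF m that] by (intro power_mono) (auto simp: dist_norm)
      finally show ?thesis by (simp add: minus_ell2.rep_eq)
    qed
    then show "\<exists>N. \<forall>k\<ge>N. (\<Sum>n<K. (ell2_nth (X m) n - ell2_nth (X k) n)\<^sup>2) \<le> e\<^sup>2" by blast
  qed
  have sq: "square_summable (\<lambda>n. ell2_nth (X m) n - l n)"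
    if "\<forall>m\<ge>M. \<forall>k\<ge>M. dist (X m) (X k) < e" "m \<ge> M" for e M m
    unfolding square_summable_def
    by (rule summableI_nonneg_bounded[where x = "e\<^sup>2"]) (simp_all add: part[OF that])
  obtain M1 where M1: "\<forall>m\<ge>M1. \<forall>k\<ge>M1. dist (X m) (X k) < 1"
    using X unfolding Cauchy_def by (meson zero_less_one)
  have "square_summable (\<lambda>n. ell2_nth (X M1) n - l n)"
    by (rule sq[OF M1 order_refl])
  from square_summable_diff[OF square_summable_nth[of "X M1"] this]
  have lsq: "square_summable l" by simp
  have "X \<longlonglongrightarrow> ell2_of l"
  proof (rule metric_LIMSEQ_I)
    fix r :: real assume "0 < r"
    then obtain M where M: "\<forall>m\<ge>M. \<forall>k\<ge>M. dist (X m) (X k) < r / 2"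
      using X unfolding Cauchy_def by (meson half_gt_zero)
    have "dist (X m) (ell2_of l) < r" if "m \<ge> M" for m
    proof -
      have "(\<lambda>n. (ell2_nth (X m) n - l n)\<^sup>2) sums (norm (X m - ell2_of l))\<^sup>2"
        using ell2_norm_square[of "X m - ell2_of l"]
        by (simp add: minus_ell2.rep_eq ell2_nth_of lsq)
      then have "(norm (X m - ell2_of l))\<^sup>2 \<le> (r / 2)\<^sup>2"
        unfolding sums_def
        by (rule LIMSEQ_le_const2) (simp add: part[OF M that])
      then have "norm (X m - ell2_of l) \<le> r / 2"
        by (rule power2_le_imp_le) (use \<open>0 < r\<close> in simp)
      then show ?thesis using \<open>0 < r\<close> by (simp add: dist_norm)
    qed
    then show "\<exists>no. \<forall>m\<ge>no. dist (X m) (ell2_of l) < r" by blast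
  qed
  then show "convergent X" by (rule convergentI)
qed


section \<open>Atlases and smooth maps\<close>

text \<open>Differentiability of class \<open>C\<^sup>k\<close> by iterating directional derivatives of the Frechet
  derivative. At a fixed finite \<open>k\<close> the top-order derivative is only required to be strongly
  continuous; between Banach spaces the conjunction over all \<open>k\<close> is nevertheless the usual
  \<open>C\<^sup>\<infinity>\<close>: strong continuity of the derivative of order \<open>k + 1\<close> makes it locally bounded (uniform
  boundedness principle), hence the derivative of order \<open>k\<close> is locally Lipschitz in operator
  norm.\<close>

fun Ck_on :: "nat \<Rightarrow> 'a::real_normed_vector set \<Rightarrow> ('a \<Rightarrow> 'b::real_normed_vector) \<Rightarrow> bool" where
  "Ck_on 0 W f \<longleftrightarrow> continuous_on W f"
| "Ck_on (Suc k) W f \<longleftrightarrow>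
     (\<exists>f'. (\<forall>x\<in>W. (f has_derivative f' x) (at x)) \<and> (\<forall>h. Ck_on k W (\<lambda>x. f' x h)))"

text \<open>Smoothness on an arbitrary, not necessarily open, subset means local extendability to smooth
  maps on open sets. This is unavoidable here: a subset of the sphere cut out by infinitely many
  strict inequalities on coordinates need not be open (and the one below has empty interior).\<close>

definition smooth_on :: "'a::real_normed_vector set \<Rightarrow> ('a \<Rightarrow> 'b::real_normed_vector) \<Rightarrow> bool" where
  "smooth_on X f \<longleftrightarrow>
     (\<forall>x\<in>X. \<exists>W F. open W \<and> x \<in> W \<and> (\<forall>k. Ck_on k W F) \<and> (\<forall>y\<in>X \<inter> W. F y = f y))"

text \<open>A chart is a domain together with a map into the model space that is injective on the domain.
  The model space may be a closed linear subspace of the type \<open>'e\<close>, as for the charts of the sphere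
  below. The topology of the manifold is the one induced by its charts.\<close>

type_synonym ('a, 'e) atlas = "('a set \<times> ('a \<Rightarrow> 'e)) set"

definition smooth_map ::
  "'a set \<Rightarrow> ('a, 'e::real_normed_vector) atlas \<Rightarrow> 'b set \<Rightarrow> ('b, 'f::real_normed_vector) atlas
    \<Rightarrow> ('a \<Rightarrow> 'b) \<Rightarrow> bool" where
  "smooth_map M A N B f \<longleftrightarrow> f ` M \<subseteq> N \<and>
     (\<forall>p\<in>M. \<exists>(D, \<phi>)\<in>A. \<exists>(E, \<psi>)\<in>B. \<exists>W. p \<in> D \<and> open W \<and> \<phi> p \<in> W \<and>
        f ` {q\<in>D. \<phi> q \<in> W} \<subseteq> E \<and>
        smooth_on (\<phi> ` {q\<in>D. \<phi> q \<in> W}) (\<psi> \<circ> f \<circ> inv_into D \<phi>))"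

definition diffeomorphism ::
  "'a set \<Rightarrow> ('a, 'e::real_normed_vector) atlas \<Rightarrow> 'b set \<Rightarrow> ('b, 'f::real_normed_vector) atlas
    \<Rightarrow> ('a \<Rightarrow> 'b) \<Rightarrow> bool" where
  "diffeomorphism M A N B f \<longleftrightarrow>
     bij_betw f M N \<and> smooth_map M A N B f \<and> smooth_map N B M A (inv_into M f)"

definition C1_curve_on ::
  "real set \<Rightarrow> 'a set \<Rightarrow> ('a, 'e::real_normed_vector) atlas \<Rightarrow> (real \<Rightarrow> 'a) \<Rightarrow> bool" where
  "C1_curve_on I M A \<gamma> \<longleftrightarrow> \<gamma> ` I \<subseteq> M \<and>
     (\<forall>t\<in>I. \<exists>(D, \<phi>)\<in>A. \<exists>J. open J \<and> t \<in> J \<and> J \<subseteq> I \<and> \<gamma> ` J \<subseteq> D \<and>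
        (\<phi> \<circ> \<gamma>) C1_differentiable_on J)"

definition pullback_atlas :: "('a \<Rightarrow> 'b) \<Rightarrow> 'a set \<Rightarrow> ('b, 'e) atlas \<Rightarrow> ('a, 'e) atlas" where
  "pullback_atlas f M B = {({q\<in>M. f q \<in> D}, \<phi> \<circ> f) | D \<phi>. (D, \<phi>) \<in> B}"


section \<open>The positive part of the unit sphere\<close>

text \<open>The chart centred at \<open>a\<close> projects the open hemisphere around \<open>a\<close> orthogonally onto the open
  unit ball of the hyperplane orthogonal to \<open>a\<close>.\<close>

definition sphere_atlas :: "(ell2, ell2) atlas" where
  "sphere_atlas =
     {({y \<in> sphere 0 1. 0 < a \<bullet> y}, \<lambda>y. y - (a \<bullet> y) *\<^sub>R a) | a. a \<in> sphere 0 1}"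

definition tangent_sphere :: "ell2 \<Rightarrow> ell2 set" where
  "tangent_sphere x = {v. x \<bullet> v = 0}"

definition round_metric :: "ell2 \<Rightarrow> ell2 \<Rightarrow> ell2 \<Rightarrow> real" where
  "round_metric x v w = v \<bullet> w"

definition pos_sphere :: "ell2 set" where
  "pos_sphere = {x \<in> sphere 0 1. \<forall>n. 0 < ell2_nth x n}"

definition pos_sphere_atlas :: "(ell2, ell2) atlas" where
  "pos_sphere_atlas = pullback_atlas (\<lambda>x. x) pos_sphere sphere_atlas"


section \<open>The probability simplex with the Fisher--Rao metric\<close>

definition prob_simplex :: "(nat \<Rightarrow> real) set" where
  "prob_simplex = {p. abs_summable p \<and> (\<Sum>n. p n) = 1 \<and> (\<forall>n. 0 < p n)}"

definition sqrt_map :: "(nat \<Rightarrow> real) \<Rightarrow> ell2" where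
  "sqrt_map p = ell2_of (\<lambda>n. sqrt (p n))"

text \<open>Charts are transported along the square-root map: by definition, the simplex carries the unique
  differentiable structure for which that bijection onto the positive part of the sphere is a
  diffeomorphism.\<close>

definition simplex_atlas :: "(nat \<Rightarrow> real, ell2) atlas" where
  "simplex_atlas = pullback_atlas sqrt_map prob_simplex pos_sphere_atlas"

definition tangent_simplex :: "(nat \<Rightarrow> real) \<Rightarrow> (nat \<Rightarrow> real) set" where
  "tangent_simplex p =
     {v. abs_summable v \<and> (\<Sum>n. v n) = 0 \<and> square_summable (\<lambda>n. v n / sqrt (p n))}"

definition fisher_rao :: "(nat \<Rightarrow> real) \<Rightarrow> (nat \<Rightarrow> real) \<Rightarrow> (nat \<Rightarrow> real) \<Rightarrow> real" where
  "fisher_rao p v w = 1 / 4 * (\<Sum>n. v n * w n / p n)"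

text \<open>Tangent vectors of the simplex are represented by entrywise derivatives of curves. The curves
  are of class \<open>C\<^sup>1\<close>: velocities of \<open>C\<^sup>2\<close> curves do not fill up
  \<^term>\<open>tangent_simplex p\<close>, because
  positivity of all entries bounds the entries of the velocity in terms of the second derivative.\<close>

definition simplex_curve ::
  "(real \<Rightarrow> nat \<Rightarrow> real) \<Rightarrow> (nat \<Rightarrow> real) \<Rightarrow> (nat \<Rightarrow> real) \<Rightarrow> bool" where
  "simplex_curve \<gamma> p v \<longleftrightarrow>
     (\<exists>\<epsilon>>0. C1_curve_on {-\<epsilon><..<\<epsilon>} prob_simplex simplex_atlas \<gamma>) \<and> \<gamma> 0 = p \<and>
     (\<forall>n. ((\<lambda>t. \<gamma> t n) has_real_derivative v n) (at 0))"

text \<open>The differential at \<open>p\<close> sends the velocity of a curve to the velocity in \<open>\<ell>\<^sup>2\<close> of the image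
  curve. The first conjunct excludes vacuous truth of the second, so at most one \<open>u\<close> qualifies.\<close>

definition d_sqrt_map :: "(nat \<Rightarrow> real) \<Rightarrow> (nat \<Rightarrow> real) \<Rightarrow> ell2" where
  "d_sqrt_map p v =
     (THE u. (\<exists>\<gamma>. simplex_curve \<gamma> p v) \<and>
        (\<forall>\<gamma>. simplex_curve \<gamma> p v \<longrightarrow> ((sqrt_map \<circ> \<gamma>) has_vector_derivative u) (at 0)))"

end

theory Submission
  imports Defs
begin

text \<open>The structure of the simplex is transported along the square-root map, so in charts this map and
  its inverse are the identity. For the metric identity the point is that every
  \<open>v \<in> T\<^sub>p\<Delta>\<close> is the velocity of some \<open>C\<^sup>1\<close> curve in the simplex. With \<open>x = \<Phi>(p)\<close> and
  \<open>u\<^sub>n = v\<^sub>n / (2 \<surd>p\<^sub>n)\<close>, the straight line \<open>x + t u\<close> may leave the positive cone at once, because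
  \<open>u\<^sub>n / x\<^sub>n\<close> can be unbounded. The curve with entries \<open>t u\<^sub>n + \<surd>(t\<^sup>2 u\<^sub>n\<^sup>2 + x\<^sub>n\<^sup>2)\<close> stays positive,
  passes through \<open>x\<close> with velocity \<open>u\<close>, and is \<open>C\<^sup>1\<close> in \<open>\<ell>\<^sup>2\<close> by dominated convergence, its entries
  being Lipschitz with constants \<open>2 \<bar>u\<^sub>n\<bar>\<close>. Normalising keeps the velocity \<open>u\<close> at \<open>t = 0\<close> since \<open>u\<close> is
  orthogonal to \<open>x\<close>. Any other curve with the same entrywise velocity is differentiable in \<open>\<ell>\<^sup>2\<close>,
  and its derivative is determined by its entries. Hence \<open>d\<Phi>\<^sub>p(v) = u\<close>.\<close>

section \<open>Limits and derivatives in \<open>\<ell>\<^sup>2\<close>\<close>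

lemma bounded_linear_ell2_nth: "bounded_linear (\<lambda>x. ell2_nth x n)"
  by (rule bounded_linear_intro[where K = 1])
    (simp_all add: plus_ell2.rep_eq scaleR_ell2.rep_eq abs_ell2_nth_le)

text \<open>Dominated convergence in the Hilbert space: the squared norm of \<open>f t - l\<close>
  is a series whose terms tend to 0 and are dominated by \<open>4 * (b n)\<^sup>2\<close>, so
  Tannery's theorem lets the limit pass under the sum.\<close>

lemma ell2_tendsto_dominated:
  assumes lim: "\<And>n. ((\<lambda>t. ell2_nth (f t) n) \<longlongrightarrow> ell2_nth l n) F"
    and bound: "\<forall>\<^sub>F t in F. \<forall>n. \<bar>ell2_nth (f t) n\<bar> \<le> b n"
    and b: "square_summable b"
  shows "(f \<longlongrightarrow> l) F"
proof (cases "F = bot")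
  case False
  \<comment> \<open>The bound passes to the limit entrywise; this needs a nontrivial filter, as does
    Tannery's theorem, hence the case split.\<close>
  have l: "\<bar>ell2_nth l n\<bar> \<le> b n" for n
    by (rule tendsto_upperbound[OF tendsto_rabs[OF lim] _ False])
      (use bound in \<open>auto elim: eventually_mono\<close>)
  have dom: "(ell2_nth (f t) n - ell2_nth l n)\<^sup>2 \<le> 4 * (b n)\<^sup>2" if "\<bar>ell2_nth (f t) n\<bar> \<le> b n" for t n
  proof -
    have "\<bar>ell2_nth (f t) n - ell2_nth l n\<bar> \<le> 2 * b n"
      using that l[of n] by linarith
    then have "\<bar>ell2_nth (f t) n - ell2_nth l n\<bar>\<^sup>2 \<le> (2 * b n)\<^sup>2"
      by (intro power_mono) auto
    then show ?thesis by (simp add: power_mult_distrib)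
  qed
  have "((\<lambda>t. \<Sum>n. (ell2_nth (f t) n - ell2_nth l n)\<^sup>2) \<longlongrightarrow> (\<Sum>n. (ell2_nth l n - ell2_nth l n)\<^sup>2)) F"
  proof (rule tannerys_theorem[THEN conjunct2, THEN conjunct2])
    show "((\<lambda>t. (ell2_nth (f t) n - ell2_nth l n)\<^sup>2) \<longlongrightarrow> (ell2_nth l n - ell2_nth l n)\<^sup>2) F" for n
      by (intro tendsto_intros lim)
    \<comment> \<open>The domination is uniform in \<open>n\<close>, so it can be pulled back along
      the second projection of the product filter.\<close>
    have "\<forall>\<^sub>F (n, t) in sequentially \<times>\<^sub>F F. \<forall>n. \<bar>ell2_nth (f t) n\<bar> \<le> b n"
      unfolding case_prod_unfold by (rule eventually_compose_filterlim[OF bound filterlim_snd])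
    then show "\<forall>\<^sub>F (n, t) in sequentially \<times>\<^sub>F F. norm ((ell2_nth (f t) n - ell2_nth l n)\<^sup>2) \<le> 4 * (b n)\<^sup>2"
      by (rule eventually_mono) (auto intro: dom)
    show "summable (\<lambda>n. 4 * (b n)\<^sup>2)"
      using b unfolding square_summable_def by (rule summable_mult)
  qed (rule False)
  moreover have "(\<Sum>n. (ell2_nth (f t) n - ell2_nth l n)\<^sup>2) = (norm (f t - l))\<^sup>2" for t
    using ell2_norm_square[of "f t - l"] by (simp add: sums_iff minus_ell2.rep_eq)
  ultimately have "((\<lambda>t. (norm (f t - l))\<^sup>2) \<longlongrightarrow> 0) F" by simp
  then have "((\<lambda>t. sqrt ((norm (f t - l))\<^sup>2)) \<longlongrightarrow> sqrt 0) F" by (rule tendsto_real_sqrt)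
  then have "((\<lambda>t. norm (f t - l)) \<longlongrightarrow> 0) F" by simp
  then show ?thesis by (metis LIM_zero_cancel tendsto_norm_zero_cancel)
qed simp

text \<open>Turns a limit of difference quotients into a Frechet derivative, so that derivatives can
  be obtained from dominated convergence.\<close>

lemma has_vector_derivative_quotientI:
  assumes "((\<lambda>t. (f t - f s) /\<^sub>R (t - s)) \<longlongrightarrow> d) (at s)"
  shows "(f has_vector_derivative d) (at s)"
  unfolding has_vector_derivative_def has_derivative_iff_norm
proof
  have "((\<lambda>t. norm ((f t - f s) /\<^sub>R (t - s) - d)) \<longlongrightarrow> 0) (at s)"
    using tendsto_norm[OF tendsto_diff[OF assms tendsto_const[of d]]] by simp
  then show "((\<lambda>t. norm (f t - f s - (t - s) *\<^sub>R d) / norm (t - s)) \<longlongrightarrow> 0) (at s)"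
  proof (rule Lim_transform_eventually)
    have "norm ((f t - f s) /\<^sub>R (t - s) - d) = norm (f t - f s - (t - s) *\<^sub>R d) / norm (t - s)"
      if "t \<noteq> s" for t
    proof -
      have "(f t - f s) /\<^sub>R (t - s) - d = (f t - f s - (t - s) *\<^sub>R d) /\<^sub>R (t - s)"
        using that by (simp add: scaleR_diff_right)
      then show ?thesis by (simp add: divide_inverse mult.commute)
    qed
    then show "\<forall>\<^sub>F t in at s. norm ((f t - f s) /\<^sub>R (t - s) - d)
        = norm (f t - f s - (t - s) *\<^sub>R d) / norm (t - s)"
      by (auto simp: eventually_at_filter)
  qed
qed (rule bounded_linear_scaleR_left)

text \<open>The Lipschitz bounds on the entries dominate the difference quotients by
  \<open>b\<close>, and the entrywise derivatives give their pointwise limits.\<close>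

lemma ell2_has_vector_derivative_dominated:
  assumes der: "\<And>n. ((\<lambda>t. ell2_nth (f t) n) has_real_derivative ell2_nth d n) (at s)"
    and lip: "\<And>t n. \<bar>ell2_nth (f t) n - ell2_nth (f s) n\<bar> \<le> b n * \<bar>t - s\<bar>"
    and b: "square_summable b"
  shows "(f has_vector_derivative d) (at s)"
proof (rule has_vector_derivative_quotientI, rule ell2_tendsto_dominated[OF _ _ b])
  have nth: "ell2_nth ((f t - f s) /\<^sub>R (t - s)) n
      = (ell2_nth (f t) n - ell2_nth (f s) n) / (t - s)" for t n
    by (simp add: scaleR_ell2.rep_eq minus_ell2.rep_eq divide_inverse mult.commute)
  show "((\<lambda>t. ell2_nth ((f t - f s) /\<^sub>R (t - s)) n) \<longlongrightarrow> ell2_nth d n) (at s)" for n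
    using der[of n] unfolding nth has_field_derivative_iff by simp
  show "\<forall>\<^sub>F t in at s. \<forall>n. \<bar>ell2_nth ((f t - f s) /\<^sub>R (t - s)) n\<bar> \<le> b n"
  proof -
    have "\<bar>ell2_nth ((f t - f s) /\<^sub>R (t - s)) n\<bar> \<le> b n" if "t \<noteq> s" for t n
      using lip[of t n] that unfolding nth by (simp add: divide_le_eq)
    then show ?thesis by (auto simp: eventually_at_filter)
  qed
qed

section \<open>Smooth maps\<close>

lemma Ck_on_const: "Ck_on k W (\<lambda>x. c)"
proof (induction k arbitrary: c)
  case (Suc k)
  then show ?case by (auto intro!: exI[of _ "\<lambda>x h. 0"])
qed simp

lemma Ck_on_ident: "Ck_on k W (\<lambda>x. x)"
proof (cases k)
  case (Suc k')
  then show ?thesis by (auto intro!: exI[of _ "\<lambda>x h. h"] Ck_on_const)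
qed simp

text \<open>The identity of the whole space serves as the smooth extension near every point,
  whatever the shape of \<open>X\<close>.\<close>

lemma smooth_on_ident:
  assumes "\<And>x. x \<in> X \<Longrightarrow> f x = x"
  shows "smooth_on X f"
  unfolding smooth_on_def
  by (intro ballI exI[of _ UNIV] exI[of _ "\<lambda>x. x"]) (auto simp: assms Ck_on_ident)

text \<open>Pairing each chart \<phi> with its pullback \<open>\<phi> \<circ> f\<close> makes the
  local representatives of \<open>f\<close> and of its inverse the identity, because
  \<open>inv_into\<close> is a right inverse on the image. Whole chart domains suffice, so the
  neighbourhood \<open>W\<close> is always \<open>UNIV\<close>.\<close>

lemma diffeomorphism_pullback_atlas:
  assumes bij: "bij_betw f M N"
    and cover: "\<And>q. q \<in> N \<Longrightarrow> \<exists>(D, \<phi>)\<in>B. q \<in> D"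
    and dom: "\<And>D \<phi>. (D, \<phi>) \<in> B \<Longrightarrow> D \<subseteq> N"
  shows "diffeomorphism M (pullback_atlas f M B) N B f"
  unfolding diffeomorphism_def
proof (intro conjI bij)
  have fM: "f ` M = N" using bij by (rule bij_betw_imp_surj_on)
  show "smooth_map M (pullback_atlas f M B) N B f"
    unfolding smooth_map_def
  proof (intro conjI ballI)
    fix p assume p: "p \<in> M"
    then have "f p \<in> N" using fM by blast
    from cover[OF this] obtain D \<phi> where D: "(D, \<phi>) \<in> B" "f p \<in> D" by blast
    have "({q \<in> M. f q \<in> D}, \<phi> \<circ> f) \<in> pullback_atlas f M B"
      using D unfolding pullback_atlas_def by blast
    moreover have "smooth_on ((\<phi> \<circ> f) ` {q \<in> {q \<in> M. f q \<in> D}. (\<phi> \<circ> f) q \<in> UNIV})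
        (\<phi> \<circ> f \<circ> inv_into {q \<in> M. f q \<in> D} (\<phi> \<circ> f))"
    proof (rule smooth_on_ident)
      fix z assume "z \<in> (\<phi> \<circ> f) ` {q \<in> {q \<in> M. f q \<in> D}. (\<phi> \<circ> f) q \<in> UNIV}"
      then have "z \<in> (\<phi> \<circ> f) ` {q \<in> M. f q \<in> D}" by simp
      from f_inv_into_f[OF this]
      show "(\<phi> \<circ> f \<circ> inv_into {q \<in> M. f q \<in> D} (\<phi> \<circ> f)) z = z" by simp
    qed
    ultimately show "\<exists>(D, \<phi>)\<in>pullback_atlas f M B. \<exists>(E, \<psi>)\<in>B. \<exists>W. p \<in> D \<and> open W \<and> \<phi> p \<in> W \<and>
        f ` {q \<in> D. \<phi> q \<in> W} \<subseteq> E \<and> smooth_on (\<phi> ` {q \<in> D. \<phi> q \<in> W}) (\<psi> \<circ> f \<circ> inv_into D \<phi>)"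
      using D p by - (rule bexI[where x = "({q \<in> M. f q \<in> D}, \<phi> \<circ> f)"], unfold prod.case,
        rule bexI[where x = "(D, \<phi>)"], unfold prod.case, rule exI[of _ UNIV], auto)
  qed (use fM in simp)
  show "smooth_map N B M (pullback_atlas f M B) (inv_into M f)"
    unfolding smooth_map_def
  proof (intro conjI ballI)
    fix q assume "q \<in> N"
    from cover[OF this] obtain D \<phi> where D: "(D, \<phi>) \<in> B" "q \<in> D" by blast
    have f_inv: "f (inv_into M f y) = y" "inv_into M f y \<in> M" if "y \<in> D" for y
      using that dom[OF D(1)] fM by (auto simp: f_inv_into_f inv_into_into)
    have "({q \<in> M. f q \<in> D}, \<phi> \<circ> f) \<in> pullback_atlas f M B"
      using D unfolding pullback_atlas_def by blast
    moreover have "smooth_on (\<phi> ` {y \<in> D. \<phi> y \<in> UNIV}) (\<phi> \<circ> f \<circ> inv_into M f \<circ> inv_into D \<phi>)"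
    proof (rule smooth_on_ident)
      fix z assume "z \<in> \<phi> ` {y \<in> D. \<phi> y \<in> UNIV}"
      then have "z \<in> \<phi> ` D" by simp
      then show "(\<phi> \<circ> f \<circ> inv_into M f \<circ> inv_into D \<phi>) z = z"
        by (simp add: f_inv inv_into_into f_inv_into_f)
    qed
    ultimately show "\<exists>(D, \<phi>)\<in>B. \<exists>(E, \<psi>)\<in>pullback_atlas f M B. \<exists>W. q \<in> D \<and> open W \<and> \<phi> q \<in> W \<and>
        inv_into M f ` {y \<in> D. \<phi> y \<in> W} \<subseteq> E \<and>
        smooth_on (\<phi> ` {y \<in> D. \<phi> y \<in> W}) (\<psi> \<circ> inv_into M f \<circ> inv_into D \<phi>)"
      using D by - (rule bexI[where x = "(D, \<phi>)"], unfold prod.case,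
        rule bexI[where x = "({q \<in> M. f q \<in> D}, \<phi> \<circ> f)"], unfold prod.case, rule exI[of _ UNIV],
        auto simp: f_inv)
  qed (use fM in \<open>auto simp: inv_into_into\<close>)
qed

section \<open>The square-root map\<close>

lemma prob_simplex_summable: "p \<in> prob_simplex \<Longrightarrow> summable p"
  unfolding prob_simplex_def by (simp add: abs_summable_imp_summable)

lemma prob_simplex_pos: "p \<in> prob_simplex \<Longrightarrow> 0 < p n"
  unfolding prob_simplex_def by simp

lemma sqrt_map_nth:
  assumes "p \<in> prob_simplex"
  shows "ell2_nth (sqrt_map p) n = sqrt (p n)"
proof -
  have "square_summable (\<lambda>n. sqrt (p n))"
    using prob_simplex_summable[OF assms] prob_simplex_pos[OF assms]
    by (simp add: square_summable_def less_imp_le)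
  then show ?thesis by (simp add: sqrt_map_def ell2_nth_of)
qed

lemma sqrt_map_in_pos_sphere:
  assumes "p \<in> prob_simplex"
  shows "sqrt_map p \<in> pos_sphere"
proof -
  have "(norm (sqrt_map p))\<^sup>2 = 1"
    using ell2_norm_square[of "sqrt_map p"] prob_simplex_pos[OF assms] assms
    by (simp add: sqrt_map_nth sums_iff less_imp_le prob_simplex_def)
  \<comment> \<open>From the squared norm the norm is 1 or -1; nonnegativity excludes the
    latter.\<close>
  then show ?thesis
    using prob_simplex_pos[OF assms] by (simp add: pos_sphere_def sqrt_map_nth assms power2_eq_1_iff)
      (metis norm_ge_zero not_one_le_zero neg_0_le_iff_le)
qed

lemma square_in_prob_simplex:
  assumes "y \<in> pos_sphere"
  shows "(\<lambda>n. (ell2_nth y n)\<^sup>2) \<in> prob_simplex"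
  using ell2_norm_square[of y] assms
  by (auto simp: prob_simplex_def pos_sphere_def abs_summable_def sums_iff less_imp_neq[symmetric])

lemma sqrt_map_square:
  assumes "y \<in> pos_sphere"
  shows "sqrt_map (\<lambda>n. (ell2_nth y n)\<^sup>2) = y"
  using assms by (intro ell2_eqI)
    (simp add: sqrt_map_nth square_in_prob_simplex pos_sphere_def less_imp_le)

lemma bij_betw_sqrt_map: "bij_betw sqrt_map prob_simplex pos_sphere"
proof (rule bij_betw_byWitness[where f' = "\<lambda>y n. (ell2_nth y n)\<^sup>2"])
  show "\<forall>p\<in>prob_simplex. (\<lambda>n. (ell2_nth (sqrt_map p) n)\<^sup>2) = p"
    by (auto simp: sqrt_map_nth prob_simplex_pos less_imp_le)
qed (auto simp: sqrt_map_square sqrt_map_in_pos_sphere square_in_prob_simplex)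

text \<open>A series of positive terms has a positive sum. Consequently the open hemisphere around
  any point of \<open>pos_sphere\<close> contains all of \<open>pos_sphere\<close>.\<close>

lemma inner_pos_sphere_pos:
  assumes "x \<in> pos_sphere" "y \<in> pos_sphere"
  shows "0 < x \<bullet> y"
  unfolding inner_ell2.rep_eq
proof (rule suminf_pos)
  show "summable (\<lambda>n. ell2_nth x n * ell2_nth y n)"
    by (rule abs_summable_imp_summable[OF square_summable_mult]) (rule square_summable_nth)+
qed (use assms in \<open>simp add: pos_sphere_def\<close>)

text \<open>The hemisphere around \<open>a\<close> cuts nothing off \<open>pos_sphere\<close>, so
  restricting its chart yields one chart for the whole manifold.\<close>

lemma pos_sphere_atlas_global_chart:
  assumes "a \<in> pos_sphere"
  shows "(pos_sphere, \<lambda>y. y - (a \<bullet> y) *\<^sub>R a) \<in> pos_sphere_atlas"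
proof -
  have "{q \<in> pos_sphere. q \<in> {y \<in> sphere 0 1. 0 < a \<bullet> y}} = pos_sphere"
    using inner_pos_sphere_pos[OF assms] by (auto simp: pos_sphere_def)
  moreover have "({y \<in> sphere 0 1. 0 < a \<bullet> y}, \<lambda>y. y - (a \<bullet> y) *\<^sub>R a) \<in> sphere_atlas"
    using assms unfolding sphere_atlas_def pos_sphere_def by blast
  then have "({q \<in> pos_sphere. q \<in> {y \<in> sphere 0 1. 0 < a \<bullet> y}},
      (\<lambda>y. y - (a \<bullet> y) *\<^sub>R a) \<circ> (\<lambda>y. y)) \<in> pos_sphere_atlas"
    unfolding pos_sphere_atlas_def pullback_atlas_def by blast
  ultimately show ?thesis by (simp only: comp_def)
qed

lemma diffeomorphism_sqrt_map:
  "diffeomorphism prob_simplex simplex_atlas pos_sphere pos_sphere_atlas sqrt_map"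
  unfolding simplex_atlas_def
proof (rule diffeomorphism_pullback_atlas[OF bij_betw_sqrt_map])
  show "\<exists>(D, \<phi>)\<in>pos_sphere_atlas. q \<in> D" if "q \<in> pos_sphere" for q
    using pos_sphere_atlas_global_chart[OF that] that by blast
  show "D \<subseteq> pos_sphere" if "(D, \<phi>) \<in> pos_sphere_atlas" for D \<phi>
    using that unfolding pos_sphere_atlas_def pullback_atlas_def by blast
qed

section \<open>Curves\<close>

text \<open>The root is the Euclidean norm of the pair \<open>(a, x)\<close>, hence 1-Lipschitz in
  \<open>a\<close> by the reverse triangle inequality; the summand \<open>a\<close> contributes the
  other 1.\<close>

lemma abs_add_sqrt_add_square_diff_le:
  fixes a b x :: real
  shows "\<bar>(a + sqrt (a\<^sup>2 + x\<^sup>2)) - (b + sqrt (b\<^sup>2 + x\<^sup>2))\<bar> \<le> 2 * \<bar>a - b\<bar>"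
proof -
  have "\<bar>norm (a, x) - norm (b, x)\<bar> \<le> norm ((a, x) - (b, x))"
    by (rule norm_triangle_ineq3)
  then have "\<bar>sqrt (a\<^sup>2 + x\<^sup>2) - sqrt (b\<^sup>2 + x\<^sup>2)\<bar> \<le> \<bar>a - b\<bar>" by (simp add: norm_Pair)
  then show ?thesis
    using abs_triangle_ineq[of "a - b" "sqrt (a\<^sup>2 + x\<^sup>2) - sqrt (b\<^sup>2 + x\<^sup>2)"]
    by (simp add: add_diff_add)
qed

text \<open>The difference quotients of the entries \<open>C\<close> and the values of their
  derivatives \<open>E\<close> are all bounded by \<open>2 * \<bar>U n\<bar>\<close>, uniformly in
  time. One square-summable majorant thus yields both differentiability of \<open>c\<close> and
  continuity of \<open>d\<close>.\<close>

lemma positive_C1_curve: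
  assumes x: "\<And>n. 0 < ell2_nth x n"
  obtains c d :: "real \<Rightarrow> ell2"
  where "\<And>t n. 0 < ell2_nth (c t) n" "c 0 = x" "d 0 = u"
    "\<And>t. (c has_vector_derivative d t) (at t)" "continuous_on UNIV d"
proof -
  define X U where "X = ell2_nth x" and "U = ell2_nth u"
  have X: "0 < X n" for n using x by (simp add: X_def)
  have root_pos: "0 < (t * U n)\<^sup>2 + (X n)\<^sup>2" for t n
    using X[of n] by (intro add_nonneg_pos) auto
  define C where "C t n = t * U n + sqrt ((t * U n)\<^sup>2 + (X n)\<^sup>2)" for t n
  define E where "E t n = U n + t * U n * U n / sqrt ((t * U n)\<^sup>2 + (X n)\<^sup>2)" for t n
  have sqU: "square_summable U" and sqX: "square_summable X"
    by (simp_all add: X_def U_def square_summable_nth)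
  have sq2U: "square_summable (\<lambda>n. 2 * \<bar>U n\<bar>)"
    using square_summable_scale[OF sqU, of 2]
    by (simp add: square_summable_def power_mult_distrib)
  have E_bound: "\<bar>E t n\<bar> \<le> 2 * \<bar>U n\<bar>" for t n
  proof -
    have "\<bar>t * U n\<bar> \<le> sqrt ((t * U n)\<^sup>2 + (X n)\<^sup>2)"
      by (rule real_le_rsqrt) simp
    then have "\<bar>t * U n\<bar> * \<bar>U n\<bar> \<le> sqrt ((t * U n)\<^sup>2 + (X n)\<^sup>2) * \<bar>U n\<bar>"
      by (rule mult_right_mono) simp
    then have "\<bar>t * U n * U n / sqrt ((t * U n)\<^sup>2 + (X n)\<^sup>2)\<bar> \<le> \<bar>U n\<bar>"
      using root_pos[of t n] by (simp add: abs_mult divide_le_eq mult.commute mult.left_commute)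
    then show ?thesis unfolding E_def by linarith
  qed
  have sqE: "square_summable (E t)" for t
    unfolding square_summable_def
  proof (rule summable_comparison_test')
    show "summable (\<lambda>n. (2 * \<bar>U n\<bar>)\<^sup>2)" using sq2U by (simp add: square_summable_def)
    show "norm ((E t n)\<^sup>2) \<le> (2 * \<bar>U n\<bar>)\<^sup>2" for n
      using power_mono[OF E_bound[of t n], of 2] by simp
  qed
  have sqC: "square_summable (C t)" for t
  proof -
    have "square_summable (\<lambda>n. sqrt ((t * U n)\<^sup>2 + (X n)\<^sup>2))"
      using square_summable_scale[OF sqU, of t] sqX
      by (simp add: square_summable_def summable_add)
    from square_summable_add[OF square_summable_scale[OF sqU, of t] this]
    show ?thesis by (simp add: C_def[abs_def])
  qed
  have C_der: "((\<lambda>t. C t n) has_real_derivative E s n) (at s)" for s n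
    unfolding C_def E_def using root_pos[of s n]
    by (auto intro!: derivative_eq_intros simp: field_simps power2_eq_square)
  have C_lip: "\<bar>C t n - C s n\<bar> \<le> 2 * \<bar>U n\<bar> * \<bar>t - s\<bar>" for s t n
  proof -
    have "\<bar>C t n - C s n\<bar> \<le> 2 * \<bar>t * U n - s * U n\<bar>"
      unfolding C_def by (rule abs_add_sqrt_add_square_diff_le)
    also have "\<dots> = 2 * \<bar>U n\<bar> * \<bar>t - s\<bar>"
      by (simp add: left_diff_distrib[symmetric] abs_mult)
    finally show ?thesis .
  qed
  define c d where "c = (\<lambda>t. ell2_of (C t))" and "d = (\<lambda>t. ell2_of (E t))"
  have c_nth: "ell2_nth (c t) = C t" and d_nth: "ell2_nth (d t) = E t" for t
    by (simp_all add: c_def d_def ell2_nth_of sqC sqE)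
  show thesis
  proof
    show "0 < ell2_nth (c t) n" for t n
    proof -
      \<comment> \<open>Strictness comes from \<open>X n > 0\<close>: the root outweighs a negative
        \<open>t * U n\<close>.\<close>
      have "\<bar>t * U n\<bar> < sqrt ((t * U n)\<^sup>2 + (X n)\<^sup>2)"
        using X[of n] by (intro real_less_rsqrt) simp
      then show ?thesis unfolding c_nth C_def by linarith
    qed
    show "c 0 = x"
      using X by (intro ell2_eqI) (simp add: c_nth C_def X_def[symmetric] less_imp_le)
    show "d 0 = u"
      by (intro ell2_eqI) (simp add: d_nth E_def U_def)
    show "(c has_vector_derivative d t) (at t)" for t
      by (rule ell2_has_vector_derivative_dominated[OF _ _ sq2U])
        (simp_all add: c_nth d_nth C_der C_lip)
    have "(d \<longlongrightarrow> d s) (at s)" for s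
    proof (rule ell2_tendsto_dominated[OF _ _ sq2U])
      show "((\<lambda>t. ell2_nth (d t) n) \<longlongrightarrow> ell2_nth (d s) n) (at s)" for n
        unfolding d_nth E_def using X[of n] by (intro tendsto_intros) simp
    qed (simp add: d_nth E_bound)
    then show "continuous_on UNIV d" by (simp add: continuous_on_def)
  qed
qed

text \<open>Product rule for \<open>c\<close> times the inverse of its norm. The radial correction
  is proportional to \<open>c t \<bullet> d t\<close>, so it vanishes at a time where position and
  velocity are orthogonal.\<close>

lemma normalised_C1_curve:
  fixes c d :: "real \<Rightarrow> 'a::real_inner"
  assumes nz: "\<And>t. c t \<noteq> 0"
    and der: "\<And>t. (c has_vector_derivative d t) (at t)"
    and cont: "continuous_on UNIV d"
  obtains e where "\<And>t. ((\<lambda>t. c t /\<^sub>R norm (c t)) has_vector_derivative e t) (at t)"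
    "continuous_on UNIV e" "norm (c 0) = 1 \<Longrightarrow> c 0 \<bullet> d 0 = 0 \<Longrightarrow> e 0 = d 0"
proof
  define e where "e t = (1 / norm (c t)) *\<^sub>R d t - ((c t \<bullet> d t) / norm (c t) ^ 3) *\<^sub>R c t" for t
  have contc: "continuous_on UNIV c"
    using der has_vector_derivative_continuous continuous_at_imp_continuous_on by blast
  show "continuous_on UNIV e"
    unfolding e_def by (intro continuous_intros cont contc) (simp_all add: nz)
  show "e 0 = d 0" if "norm (c 0) = 1" "c 0 \<bullet> d 0 = 0"
    using that by (simp add: e_def)
  show "((\<lambda>t. c t /\<^sub>R norm (c t)) has_vector_derivative e t) (at t)" for t
  proof -
    have "((\<lambda>t. c t \<bullet> c t) has_vector_derivative 2 * (c t \<bullet> d t)) (at t)"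
      using bounded_bilinear.has_vector_derivative[OF bounded_bilinear_inner der der]
      by (simp add: inner_commute)
    then have ip: "((\<lambda>t. c t \<bullet> c t) has_real_derivative 2 * (c t \<bullet> d t)) (at t)"
      by (simp add: has_real_derivative_iff_has_vector_derivative)
    have pos: "0 < c t \<bullet> c t" using nz[of t] by simp
    \<comment> \<open>The norm is differentiated as the root of the inner product, which stays
      positive as \<open>c\<close> avoids 0.\<close>
    have "((\<lambda>t. inverse (sqrt (c t \<bullet> c t))) has_real_derivative
        - ((c t \<bullet> d t) / sqrt (c t \<bullet> c t) ^ 3)) (at t)"
      using pos by (auto intro!: derivative_eq_intros ip simp del: inner_gt_zero_iff inner_ge_zero
        simp: field_simps power3_eq_cube)
    then have "((\<lambda>t. inverse (norm (c t))) has_real_derivative - ((c t \<bullet> d t) / norm (c t) ^ 3)) (at t)"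
      by (simp only: norm_eq_sqrt_inner)
    from has_vector_derivative_scaleR[OF this der[of t]]
    show ?thesis by (simp add: e_def divide_inverse)
  qed
qed

section \<open>Tangency of the candidate and the metric identity\<close>

text \<open>The entries of the candidate for the differential: \<open>(\<surd>q)' = q' / (2 \<surd>q)\<close>.\<close>

definition half_score :: "(nat \<Rightarrow> real) \<Rightarrow> (nat \<Rightarrow> real) \<Rightarrow> ell2" where
  "half_score p v = ell2_of (\<lambda>n. v n / (2 * sqrt (p n)))"

lemma half_score_nth:
  assumes "v \<in> tangent_simplex p"
  shows "ell2_nth (half_score p v) n = v n / (2 * sqrt (p n))"
proof -
  have "square_summable (\<lambda>n. 1 / 2 * (v n / sqrt (p n)))"
    using assms unfolding tangent_simplex_def by (intro square_summable_scale) simp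
  then show ?thesis by (simp add: half_score_def ell2_nth_of)
qed

text \<open>The products of entries are \<open>v n / 2\<close>, so orthogonality to the position is
  the condition that \<open>v\<close> sums to 0.\<close>

lemma inner_sqrt_map_half_score:
  assumes p: "p \<in> prob_simplex" and v: "v \<in> tangent_simplex p"
  shows "sqrt_map p \<bullet> half_score p v = 0"
proof -
  have eq: "ell2_nth (sqrt_map p) n * ell2_nth (half_score p v) n = v n / 2" for n
    using prob_simplex_pos[OF p, of n] by (simp add: sqrt_map_nth[OF p] half_score_nth[OF v])
  have "summable v" "(\<Sum>n. v n) = 0"
    using v by (simp_all add: tangent_simplex_def abs_summable_imp_summable)
  then show ?thesis
    using suminf_divide[of v 2] by (simp add: inner_ell2.rep_eq eq)
qed

text \<open>The two factors 1/2 from differentiating the square root produce the 1/4 of the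
  Fisher-Rao metric.\<close>

lemma inner_half_score:
  assumes p: "p \<in> prob_simplex" and v: "v \<in> tangent_simplex p" and w: "w \<in> tangent_simplex p"
  shows "half_score p v \<bullet> half_score p w = fisher_rao p v w"
proof -
  have eq: "v n * w n / p n = 4 * (ell2_nth (half_score p v) n * ell2_nth (half_score p w) n)" for n
    using prob_simplex_pos[OF p, of n] by (simp add: half_score_nth[OF v] half_score_nth[OF w])
  have "summable (\<lambda>n. ell2_nth (half_score p v) n * ell2_nth (half_score p w) n)"
    by (rule abs_summable_imp_summable[OF square_summable_mult]) (rule square_summable_nth)+
  from suminf_mult[OF this, of 4] show ?thesis
    by (simp add: fisher_rao_def inner_ell2.rep_eq eq)
qed

section \<open>Curves in the simplex and their velocities\<close>

text \<open>Squaring the entries of a normalised positive curve through \<open>sqrt_map p\<close>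
  with velocity \<open>half_score p v\<close> gives a curve in the simplex; its entries have
  derivative \<open>2 * ell2_nth x n * ell2_nth u n = v n\<close> at 0.\<close>

lemma simplex_curve_exists:
  assumes p: "p \<in> prob_simplex" and v: "v \<in> tangent_simplex p"
  shows "\<exists>\<gamma>. simplex_curve \<gamma> p v"
proof -
  define x u where "x = sqrt_map p" and "u = half_score p v"
  have x: "x \<in> pos_sphere" unfolding x_def by (rule sqrt_map_in_pos_sphere[OF p])
  then have xpos: "\<And>n. 0 < ell2_nth x n" and xnorm: "norm x = 1"
    by (simp_all add: pos_sphere_def)
  obtain c d where c: "\<And>t n. 0 < ell2_nth (c t) n" "c 0 = x" "d 0 = u"
      "\<And>t. (c has_vector_derivative d t) (at t)" "continuous_on UNIV d"
    using positive_C1_curve[OF xpos] by metis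
  have nz: "c t \<noteq> 0" for t
    using c(1)[of t 0] by (auto simp: zero_ell2.rep_eq)
  define y where "y t = c t /\<^sub>R norm (c t)" for t
  obtain e where e: "\<And>t. (y has_vector_derivative e t) (at t)" "continuous_on UNIV e"
      "norm (c 0) = 1 \<Longrightarrow> c 0 \<bullet> d 0 = 0 \<Longrightarrow> e 0 = d 0"
    using normalised_C1_curve[OF nz c(4,5)] unfolding y_def by metis
  have y0: "y 0 = x" by (simp add: y_def c xnorm)
  have e0: "e 0 = u"
    using e(3) inner_sqrt_map_half_score[OF p v] by (simp add: c xnorm x_def[symmetric] u_def[symmetric])
  have y: "y t \<in> pos_sphere" for t
    using nz[of t] c(1)[of t] by (simp add: pos_sphere_def y_def scaleR_ell2.rep_eq)
  define \<gamma> where "\<gamma> t n = (ell2_nth (y t) n)\<^sup>2" for t n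
  have \<gamma>: "\<gamma> t \<in> prob_simplex" "sqrt_map (\<gamma> t) = y t" for t
    using square_in_prob_simplex[OF y] sqrt_map_square[OF y] by (simp_all add: \<gamma>_def[abs_def])
  \<comment> \<open>The global chart centred at \<open>x\<close>. It is the restriction of a bounded
    linear map, so it carries the derivative of \<open>y\<close> to that of the chart representative
    at every time.\<close>
  define \<phi> where "\<phi> z = z - (x \<bullet> z) *\<^sub>R x" for z
  have lin: "bounded_linear \<phi>"
    unfolding \<phi>_def by (intro bounded_linear_sub bounded_linear_ident
      bounded_linear_compose[OF bounded_linear_scaleR_left] bounded_linear_inner_right)
  have "(pos_sphere, \<phi>) \<in> pos_sphere_atlas"
    unfolding \<phi>_def by (rule pos_sphere_atlas_global_chart[OF x])
  then have chart: "({q \<in> prob_simplex. sqrt_map q \<in> pos_sphere}, \<phi> \<circ> sqrt_map) \<in> simplex_atlas"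
    unfolding simplex_atlas_def pullback_atlas_def by blast
  have "(\<phi> \<circ> sqrt_map \<circ> \<gamma>) C1_differentiable_on J" for J
    unfolding C1_differentiable_on_def
  proof (intro exI[of _ "\<lambda>t. \<phi> (e t)"] conjI ballI)
    show "(\<phi> \<circ> sqrt_map \<circ> \<gamma> has_vector_derivative \<phi> (e t)) (at t)" for t
      using bounded_linear.has_vector_derivative[OF lin e(1)] by (simp add: comp_def \<gamma>)
    show "continuous_on J (\<lambda>t. \<phi> (e t))"
      by (rule bounded_linear.continuous_on[OF lin continuous_on_subset[OF e(2)]]) simp
  qed
  then have "C1_curve_on {-1<..<1} prob_simplex simplex_atlas \<gamma>"
    unfolding C1_curve_on_def
    using \<gamma> y by (intro conjI ballI bexI[OF _ chart]) (auto intro!: exI[of _ "{-1<..<1::real}"])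
  moreover have "\<gamma> 0 = p"
    using prob_simplex_pos[OF p] by (auto simp: \<gamma>_def y0 x_def sqrt_map_nth[OF p] less_imp_le)
  moreover have "((\<lambda>t. \<gamma> t n) has_real_derivative v n) (at 0)" for n
  proof -
    have "((\<lambda>t. ell2_nth (y t) n) has_real_derivative ell2_nth u n) (at 0)"
      using bounded_linear.has_vector_derivative[OF bounded_linear_ell2_nth e(1)] e0
      by (metis has_real_derivative_iff_has_vector_derivative)
    then have "((\<lambda>t. \<gamma> t n) has_real_derivative 2 * ell2_nth x n * ell2_nth u n) (at 0)"
      unfolding \<gamma>_def by (auto intro!: derivative_eq_intros simp: y0)
    then show ?thesis
      using prob_simplex_pos[OF p, of n]
      by (simp add: x_def u_def sqrt_map_nth[OF p] half_score_nth[OF v])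
  qed
  ultimately show ?thesis
    unfolding simplex_curve_def by (intro exI[of _ \<gamma>]) (auto intro!: exI[of _ "1::real"])
qed

text \<open>Being C1 in a chart gives differentiability in norm once the chart is inverted by a
  differentiable formula; the derivative is then read off from its entries, coordinates being
  bounded linear.\<close>

lemma simplex_curve_velocity:
  assumes p: "p \<in> prob_simplex" and v: "v \<in> tangent_simplex p" and \<gamma>: "simplex_curve \<gamma> p v"
  shows "((sqrt_map \<circ> \<gamma>) has_vector_derivative half_score p v) (at 0)"
proof -
  obtain \<epsilon> where \<epsilon>: "0 < \<epsilon>" and C1: "C1_curve_on {-\<epsilon><..<\<epsilon>} prob_simplex simplex_atlas \<gamma>"
    and \<gamma>0: "\<gamma> 0 = p" and der: "\<And>n. ((\<lambda>t. \<gamma> t n) has_real_derivative v n) (at 0)"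
    using \<gamma> unfolding simplex_curve_def by blast
  have in_simplex: "\<gamma> t \<in> prob_simplex" if "t \<in> {-\<epsilon><..<\<epsilon>}" for t
    using C1 that unfolding C1_curve_on_def by blast
  have "0 \<in> {-\<epsilon><..<\<epsilon>}" using \<epsilon> by simp
  then obtain D \<phi> J where D: "(D, \<phi>) \<in> simplex_atlas" and J: "open J" "0 \<in> J" "J \<subseteq> {-\<epsilon><..<\<epsilon>}"
    and JD: "\<gamma> ` J \<subseteq> D" and diff: "(\<phi> \<circ> \<gamma>) C1_differentiable_on J"
    using C1 unfolding C1_curve_on_def by blast
  obtain D' \<phi>' where D': "(D', \<phi>') \<in> pos_sphere_atlas"
    "D = {q \<in> prob_simplex. sqrt_map q \<in> D'}" "\<phi> = \<phi>' \<circ> sqrt_map"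
    using D unfolding simplex_atlas_def pullback_atlas_def by blast
  obtain a where "a \<in> sphere 0 1"
    and D'_eq: "D' = {y \<in> pos_sphere. y \<in> {y \<in> sphere 0 1. 0 < a \<bullet> y}}"
    and \<phi>'_eq: "\<phi>' = (\<lambda>y. y - (a \<bullet> y) *\<^sub>R a) \<circ> (\<lambda>y. y)"
    using D'(1) unfolding pos_sphere_atlas_def sphere_atlas_def pullback_atlas_def by blast
  then have a: "norm a = 1" "D \<subseteq> {q. 0 < a \<bullet> sqrt_map q}"
      "\<phi> = (\<lambda>q. sqrt_map q - (a \<bullet> sqrt_map q) *\<^sub>R a)"
    using D'(2,3) by (auto simp: comp_def)
  define y z where "y = sqrt_map \<circ> \<gamma>" and "z = \<phi> \<circ> \<gamma>"
  obtain z' where z': "(z has_vector_derivative z') (at 0)"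
    using diff J(2) unfolding z_def C1_differentiable_on_def by blast
  have ysphere: "y t \<in> pos_sphere" if "t \<in> J" for t
    using that J(3) in_simplex sqrt_map_in_pos_sphere by (auto simp: y_def)
  have ypos: "0 < a \<bullet> y t" if "t \<in> J" for t
    using that JD a(2) by (auto simp: y_def)
  have z: "z t = y t - (a \<bullet> y t) *\<^sub>R a" for t
    by (simp add: z_def y_def a(3))
  have "z t \<bullet> z t = 1 - (a \<bullet> y t)\<^sup>2" if "t \<in> J" for t
  proof -
    have "y t \<bullet> y t = 1" "a \<bullet> a = 1"
      using ysphere[OF that] a(1) by (simp_all add: pos_sphere_def norm_eq_1)
    then show ?thesis
      unfolding z by (simp add: inner_diff_left inner_diff_right inner_commute power2_eq_square)
  qed
  then have zz: "1 - z t \<bullet> z t = (a \<bullet> y t)\<^sup>2" if "t \<in> J" for t using that by simp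
  txt \<open>The inverse of the chart centred at \<open>a\<close> is \<open>z \<mapsto> z + \<surd>(1 - \<bar>z\<bar>\<^sup>2) a\<close>.\<close>
  have y_eq: "z t + sqrt (1 - z t \<bullet> z t) *\<^sub>R a = y t" if "t \<in> J" for t
  proof -
    have "sqrt (1 - z t \<bullet> z t) = a \<bullet> y t"
      using ypos[OF that] by (simp add: zz[OF that])
    then show ?thesis by (simp only: z diff_add_cancel)
  qed
  have "((\<lambda>t. z t \<bullet> z t) has_vector_derivative 2 * (z 0 \<bullet> z')) (at 0)"
    using bounded_bilinear.has_vector_derivative[OF bounded_bilinear_inner z' z']
    by (simp add: inner_commute)
  then have ip: "((\<lambda>t. z t \<bullet> z t) has_real_derivative 2 * (z 0 \<bullet> z')) (at 0)"
    by (simp add: has_real_derivative_iff_has_vector_derivative)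
  \<comment> \<open>The point lies strictly inside the hemisphere, so the square root is taken away
    from 0, where it is differentiable.\<close>
  have "0 < 1 - z 0 \<bullet> z 0" using zz[OF J(2)] ypos[OF J(2)] by simp
  then obtain s where s: "((\<lambda>t. sqrt (1 - z t \<bullet> z t)) has_real_derivative s) (at 0)"
    using DERIV_chain2[OF DERIV_real_sqrt DERIV_diff[OF DERIV_const ip]] by blast
  have "((\<lambda>t. z t + sqrt (1 - z t \<bullet> z t) *\<^sub>R a) has_vector_derivative z' + s *\<^sub>R a) (at 0)"
    using has_vector_derivative_add[OF z'
      has_vector_derivative_scaleR[OF s has_vector_derivative_const[of a]]] by simp
  then have y': "(y has_vector_derivative z' + s *\<^sub>R a) (at 0)"
    by (rule has_vector_derivative_transform_within_open[OF _ J(1,2)]) (rule y_eq)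
  have "z' + s *\<^sub>R a = half_score p v"
  proof (rule ell2_eqI)
    fix n
    have "((\<lambda>t. ell2_nth (y t) n) has_real_derivative ell2_nth (z' + s *\<^sub>R a) n) (at 0)"
      using bounded_linear.has_vector_derivative[OF bounded_linear_ell2_nth y']
      by (simp add: has_real_derivative_iff_has_vector_derivative)
    moreover have "((\<lambda>t. sqrt (\<gamma> t n)) has_real_derivative v n / (2 * sqrt (p n))) (at 0)"
      using prob_simplex_pos[OF p, of n]
      by (auto intro!: derivative_eq_intros der simp: \<gamma>0 field_simps)
    \<comment> \<open>The entries of \<open>y\<close> are known to be square roots only while
      \<gamma> stays in the simplex, hence the comparison on the neighbourhood
      \<open>J\<close>.\<close>
    then have "((\<lambda>t. ell2_nth (y t) n) has_real_derivative v n / (2 * sqrt (p n))) (at 0)"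
      by (rule DERIV_cong_ev[OF refl _ refl, THEN iffD1, rotated])
        (use J in_simplex in \<open>auto simp: eventually_nhds y_def sqrt_map_nth intro!: exI[of _ J]\<close>)
    ultimately show "ell2_nth (z' + s *\<^sub>R a) n = ell2_nth (half_score p v) n"
      unfolding half_score_nth[OF v] by (rule DERIV_unique)
  qed
  then show ?thesis using y' by (simp add: y_def)
qed

section \<open>The differential and the isometry\<close>

text \<open>Some curve has velocity \<open>v\<close>, and its image has only one derivative at 0, so
  the description defining the differential has exactly one solution.\<close>

lemma d_sqrt_map_eq:
  assumes "p \<in> prob_simplex" "v \<in> tangent_simplex p"
  shows "d_sqrt_map p v = half_score p v"
  unfolding d_sqrt_map_def
proof (rule the_equality)
  show "(\<exists>\<gamma>. simplex_curve \<gamma> p v) \<and>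
      (\<forall>\<gamma>. simplex_curve \<gamma> p v \<longrightarrow> ((sqrt_map \<circ> \<gamma>) has_vector_derivative half_score p v) (at 0))"
    using simplex_curve_exists[OF assms] simplex_curve_velocity[OF assms] by blast
next
  fix u
  assume "(\<exists>\<gamma>. simplex_curve \<gamma> p v) \<and>
    (\<forall>\<gamma>. simplex_curve \<gamma> p v \<longrightarrow> ((sqrt_map \<circ> \<gamma>) has_vector_derivative u) (at 0))"
  then show "u = half_score p v"
    using simplex_curve_velocity[OF assms] vector_derivative_unique_at by blast
qed

theorem theorem2p2:
  shows "diffeomorphism prob_simplex simplex_atlas pos_sphere pos_sphere_atlas sqrt_map \<and>
    (\<forall>p\<in>prob_simplex. \<forall>v\<in>tangent_simplex p. \<forall>w\<in>tangent_simplex p.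
       d_sqrt_map p v \<in> tangent_sphere (sqrt_map p) \<and>
       d_sqrt_map p w \<in> tangent_sphere (sqrt_map p) \<and>
       round_metric (sqrt_map p) (d_sqrt_map p v) (d_sqrt_map p w) = fisher_rao p v w)"
  by (simp add: diffeomorphism_sqrt_map d_sqrt_map_eq tangent_sphere_def round_metric_def
    inner_sqrt_map_half_score inner_half_score)

end
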